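(* Let $(\Omega,\mathcal F,\mathbb P)$ be a probability space and $\sigma:\Omega\to\Omega$ an invertible, ergodic, $\mathbb P$-preserving transformation. Let $(\mathcal B_w,\|\cdot\|_w)$ and $(\mathcal B_s,\|\cdot\|_s)$ be Banach spaces such that $\mathcal B_s$ is embedded in $\mathcal B_w$ and $\|\cdot\|_w\le\|\cdot\|_s$ on $\mathcal B_s$. Let $I\subset(-1,1)$ be an interval with $0\in I$, and for each $\omega\in\Omega$, $\epsilon\in I$ let $\mathcal L_{\omega,\epsilon}$ be a bounded operator on both $\mathcal B_w$ and $\mathcal B_s$. Let $\psi\in\mathcal B_s'$ be a nonzero bounded functional admitting a bounded extension to $\mathcal B_w$ (still denoted $\psi$) such that $\mathcal L_{\omega,\epsilon}^*\psi=\psi$ for all $\omega\in\Omega$, $\epsilon\in I$. Let $(\epsilon_k)_{k\in\mathbb N}$ be a sequence in $I\setminus\{0\}$ with $\lim_{k\to\infty}\epsilon_k=0$, set $\epsilon_0:=0$, and write $\mathcal L_{\omega,k}:=\mathcal L_{\omega,\epsilon_k}$ for $k\in\mathbb N_0$ and $\mathcal L_\omega:=\mathcal L_{\omega,0}$. Assume that there exist a $\sigma$-invariant set $\Omega'\subset\Omega$ of full measure and a tempered random variable $C\in\mathcal K$ such that: (1) for $\omega\in\Omega'$ and $k\in\mathbb N_0$ there exists $h_{\omega,k}\in\mathcal B_s$ such that $\psi(h_{\omega,k})=1$, $\mathcal L_{\omega,k}h_{\omega,k}=h_{\sigma\omega,k}$ and $\|h_{\omega,k}\|_s\le C(\omega)$;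 (2) for $\omega\in\Omega'$, $h\in\mathcal B_s$ and $n\in\mathbb N$, $\|\mathcal L^n_{\sigma^{-n}\omega}h\|_w\le C(\omega)\|h\|_w$; (3) there exists $\lambda>0$ such that $\|\mathcal L^n_\omega h\|_w\le C(\omega)e^{-\lambda n}\|h\|_w$ for $\omega\in\Omega'$, $n\in\mathbb N$ and $h\in V_s:=\{h\in\mathcal B_s:\psi(h)=0\}$; (4) for $\omega\in\Omega'$, $k\in\mathbb N$ and $h\in\mathcal B_s$, $\|(\mathcal L_{\omega,k}-\mathcal L_\omega)h\|_w\le C(\omega)|\epsilon_k|\,\|h\|_s$. Then there exist $\tilde C\in\mathcal K$ and $r>0$ such that $$\|h_{\omega,k}-h_\omega\|_w\le\tilde C(\omega)|\epsilon_k|^r$$ for $\mathbb P$-a.e. $\omega\in\Omega$ and all $k\in\mathbb N$, where $h_\omega:=h_{\omega,0}$. In particular, $\lim_{k\to\infty}h_{\omega,k}=h_\omega$ in $\mathcal B_w$ for $\mathbb P$-a.e. $\omega\in\Omega$.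
   Context: A random variable $K:\Omega\to(0,\infty)$ is called tempered if $\lim_{n\to\pm\infty}\frac1n\log K(\sigma^n\omega)=0$ for $\mathbb P$-a.e. $\omega\in\Omega$; $\mathcal K$ denotes the set of all tempered random variables. For $n\in\mathbb N$, $\mathcal L^n_{\omega,\epsilon}:=\mathcal L_{\sigma^{n-1}\omega,\epsilon}\circ\cdots\circ\mathcal L_{\sigma\omega,\epsilon}\circ\mathcal L_{\omega,\epsilon}$ and $\mathcal L^n_\omega:=\mathcal L^n_{\omega,0}$. The condition $\mathcal L_{\omega,\epsilon}^*\psi=\psi$ means $\psi(\mathcal L_{\omega,\epsilon}h)=\psi(h)$ for all $h$. *)

theory Defs
  imports "HOL-Probability.Probability"
begin

section \<open>Banach spaces over a scalar field\<close>

text \<open>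
  The field of scalars is left open. By the Gelfand-Mazur theorem a \<open>real_normed_field\<close> is
  isometrically isomorphic to the real or to the complex numbers, so the locale below describes
  exactly the real and the complex Banach spaces: \<open>scale\<close> is the scalar multiplication, and it
  is compatible with the real vector space structure and the norm of the type class \<open>banach\<close>.
\<close>

locale banach_over = vector_space scale
  for scale :: "'k::real_normed_field \<Rightarrow> 'b::banach \<Rightarrow> 'b" +
  assumes scale_of_real: "scale (of_real r) x = r *\<^sub>R x"
    and norm_scale: "norm (scale c x) = norm c * norm x"

lemma banach_over_scaleR: "banach_over ((*\<^sub>R) :: real \<Rightarrow> 'b::banach \<Rightarrow> 'b)"
  by unfold_locales (simp_all add: algebra_simps)

lemma banach_over_mult: "banach_over ((*) :: 'k \<Rightarrow> 'k::{real_normed_field,banach} \<Rightarrow> 'k)"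
  by unfold_locales (simp_all add: algebra_simps scaleR_conv_of_real norm_mult)

definition bounded_linear_over ::
  "('k \<Rightarrow> 'a \<Rightarrow> 'a) \<Rightarrow> ('k \<Rightarrow> 'b \<Rightarrow> 'b) \<Rightarrow> ('a::real_normed_vector \<Rightarrow> 'b::real_normed_vector) \<Rightarrow> bool"
where
  "bounded_linear_over scale\<^sub>1 scale\<^sub>2 f \<longleftrightarrow>
     bounded_linear f \<and> (\<forall>c x. f (scale\<^sub>1 c x) = scale\<^sub>2 c (f x))"

section \<open>Invertible ergodic systems\<close>

definition inv_on :: "'o measure \<Rightarrow> ('o \<Rightarrow> 'o) \<Rightarrow> 'o \<Rightarrow> 'o" where
  "inv_on M \<sigma> = the_inv_into (space M) \<sigma>"

definition int_iterate :: "'o measure \<Rightarrow> ('o \<Rightarrow> 'o) \<Rightarrow> int \<Rightarrow> 'o \<Rightarrow> 'o" where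
  "int_iterate M \<sigma> n = (if 0 \<le> n then \<sigma> ^^ nat n else inv_on M \<sigma> ^^ nat (- n))"

locale invertible_ergodic_system = prob_space M
  for M :: "'o measure" +
  fixes \<sigma> :: "'o \<Rightarrow> 'o"
  assumes bij: "bij_betw \<sigma> (space M) (space M)"
    and measurable: "\<sigma> \<in> M \<rightarrow>\<^sub>M M"
    and measurable_inv: "inv_on M \<sigma> \<in> M \<rightarrow>\<^sub>M M"
    and preserving: "distr M M \<sigma> = M"
    and ergodic: "A \<in> sets M \<Longrightarrow> \<sigma> -` A \<inter> space M = A \<Longrightarrow> measure M A = 0 \<or> measure M A = 1"

definition invariant_full_set :: "'o measure \<Rightarrow> ('o \<Rightarrow> 'o) \<Rightarrow> 'o set \<Rightarrow> bool" where
  "invariant_full_set M \<sigma> A \<longleftrightarrow>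
     A \<in> sets M \<and> \<sigma> -` A \<inter> space M = A \<and> measure M A = 1"

definition tempered :: "'o measure \<Rightarrow> ('o \<Rightarrow> 'o) \<Rightarrow> ('o \<Rightarrow> real) \<Rightarrow> bool" where
  "tempered M \<sigma> K \<longleftrightarrow>
     K \<in> borel_measurable M \<and> (\<forall>\<omega>\<in>space M. 0 < K \<omega>) \<and>
     (AE \<omega> in M.
        ((\<lambda>n::int. 1 / of_int n * ln (K (int_iterate M \<sigma> n \<omega>))) \<longlongrightarrow> 0) at_top \<and>
        ((\<lambda>n::int. 1 / of_int n * ln (K (int_iterate M \<sigma> n \<omega>))) \<longlongrightarrow> 0) at_bot)"

primrec cocycle :: "('o \<Rightarrow> 'o) \<Rightarrow> ('o \<Rightarrow> real \<Rightarrow> 'b \<Rightarrow> 'b) \<Rightarrow> nat \<Rightarrow> 'o \<Rightarrow> real \<Rightarrow> 'b \<Rightarrow> 'b" where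
  "cocycle \<sigma> L 0 \<omega> \<epsilon> = id"
| "cocycle \<sigma> L (Suc n) \<omega> \<epsilon> = L ((\<sigma> ^^ n) \<omega>) \<epsilon> \<circ> cocycle \<sigma> L n \<omega> \<epsilon>"

end

theory Submission
  imports Defs
begin

text \<open>
  Fix \<open>\<omega>\<close>, write \<open>\<theta> j\<close> for the \<open>j\<close>-th backward iterate of \<open>\<omega>\<close>, and let \<open>T j\<close> be the unperturbed
  cocycle from the fibre over \<open>\<theta> j\<close> to the fibre over \<open>\<omega>\<close>. For each length \<open>n\<close> of the past,
  equivariance gives
  \<open>h \<omega> k - h \<omega> 0 = (h \<omega> k - T n (h (\<theta> n) k)) + T n (h (\<theta> n) k - h (\<theta> n) 0)\<close>.
  The first bracket telescopes along the backward orbit into \<open>n\<close> terms, each a one-step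
  perturbation carried forward by an unperturbed cocycle whose weak norm is controlled at the
  endpoint \<open>\<omega>\<close>; each costs a factor \<open>\<bar>\<epsilon> k\<bar>\<close> times values of \<open>C\<close> along the past
  (\<open>norm_telescoping_le\<close>). In the second bracket both vectors have \<open>\<psi> = 1\<close>, so the difference
  lies in the kernel of \<open>\<psi>\<close> and contracts like \<open>exp (- \<Lambda> n)\<close>.

  The values of \<open>C\<close> along the past may be unbounded, but temperedness makes them subexponential: for
  every \<open>\<delta> > 0\<close> they are at most \<open>D \<omega> * exp (\<delta> n)\<close> with \<open>D\<close> again tempered
  (\<open>tempered_envelope\<close>). With \<open>\<delta> = \<Lambda> / 8\<close>, two factors of \<open>C\<close> cost \<open>exp (\<Lambda> n / 4)\<close>, which the
  contraction absorbs. The two errors are then of order \<open>\<bar>\<epsilon> k\<bar> n exp (\<Lambda> n / 4)\<close> and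
  \<open>exp (- 3 \<Lambda> n / 4)\<close>; for \<open>n\<close> close to \<open>ln (1 / \<bar>\<epsilon> k\<bar>) / \<Lambda>\<close> both are at most a constant
  times the square root of \<open>\<bar>\<epsilon> k\<bar>\<close> (\<open>balance_exponentials\<close>). This gives the exponent \<open>1/2\<close> and the
  tempered constant \<open>c * D \<omega> ^ 3\<close>, the third factor \<open>D \<omega>\<close> coming from the growth bound at \<open>\<omega>\<close>.
\<close>

section \<open>Sequences of sublinear growth\<close>

text \<open>
  Applied to \<open>b n = ln (K (\<sigma>\<^sup>n \<omega>))\<close>, this is temperedness at \<open>\<omega>\<close>. A bound valid for all \<open>n\<close> is more
  convenient than a pair of limits: estimates at shifted indices need no bookkeeping of how large
  an index has to be.
\<close>

definition sublinear :: "(int \<Rightarrow> real) \<Rightarrow> bool" where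
  "sublinear b \<longleftrightarrow> (\<forall>\<delta>>0. \<exists>B. \<forall>n. \<bar>b n\<bar> \<le> B + \<delta> * \<bar>of_int n\<bar>)"

lemma sublinear_if_tendsto:
  assumes top: "((\<lambda>n::int. 1 / of_int n * b n) \<longlongrightarrow> (0::real)) at_top"
    and bot: "((\<lambda>n::int. 1 / of_int n * b n) \<longlongrightarrow> 0) at_bot"
  shows "sublinear b"
  unfolding sublinear_def
proof (intro allI impI)
  fix \<delta> :: real
  assume \<delta>: "\<delta> > 0"
  obtain N where N: "\<And>n. n \<ge> N \<Longrightarrow> \<bar>1 / of_int n * b n\<bar> < \<delta>"
    using tendstoD[OF top \<delta>] by (auto simp: eventually_at_top_linorder dist_real_def)
  obtain N' where N': "\<And>n. n \<le> N' \<Longrightarrow> \<bar>1 / of_int n * b n\<bar> < \<delta>"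
    using tendstoD[OF bot \<delta>] by (auto simp: eventually_at_bot_linorder dist_real_def)
  have far: "\<bar>b n\<bar> \<le> \<delta> * \<bar>of_int n\<bar>" if "n \<noteq> 0" "n \<ge> N \<or> n \<le> N'" for n
    using N[of n] N'[of n] that by (auto simp: abs_mult field_simps)
  let ?S = "insert 0 {N'..N}"
  have "\<bar>b n\<bar> \<le> (\<Sum>m\<in>?S. \<bar>b m\<bar>) + \<delta> * \<bar>of_int n\<bar>" for n
  proof (cases "n \<in> ?S")
    case True
    then have "\<bar>b n\<bar> \<le> (\<Sum>m\<in>?S. \<bar>b m\<bar>)"
      by (intro member_le_sum) auto
    then show ?thesis
      using \<delta> by (smt (verit) mult_nonneg_nonneg abs_ge_zero)
  next
    case False
    then have "\<bar>b n\<bar> \<le> \<delta> * \<bar>of_int n\<bar>"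
      by (intro far) auto
    moreover have "0 \<le> (\<Sum>m\<in>?S. \<bar>b m\<bar>)"
      by (intro sum_nonneg) auto
    ultimately show ?thesis by linarith
  qed
  then show "\<exists>B. \<forall>n. \<bar>b n\<bar> \<le> B + \<delta> * \<bar>of_int n\<bar>" by blast
qed

lemma sublinear_imp_small_ratio:
  assumes "sublinear b" "e > 0"
  obtains N :: int where "\<And>n. \<bar>n\<bar> \<ge> N \<Longrightarrow> \<bar>1 / of_int n * b n\<bar> < e"
proof -
  obtain B where B: "\<And>n. \<bar>b n\<bar> \<le> B + e / 2 * \<bar>of_int n\<bar>"
    using assms unfolding sublinear_def by (meson half_gt_zero)
  define N where "N = max 1 (\<lceil>2 * B / e\<rceil> + 1)"
  have "\<bar>1 / of_int n * b n\<bar> < e" if "\<bar>n\<bar> \<ge> N" for n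
  proof -
    have pos: "0 < \<bar>real_of_int n\<bar>" using that by (auto simp: N_def)
    have "2 * B / e < real_of_int \<bar>n\<bar>"
      using that unfolding N_def by linarith
    then have "B < e / 2 * \<bar>real_of_int n\<bar>"
      using assms(2) by (simp add: field_simps)
    then have "\<bar>b n\<bar> < e * \<bar>real_of_int n\<bar>"
      using B[of n] by linarith
    then show ?thesis using pos by (simp add: abs_mult field_simps)
  qed
  then show thesis using that by blast
qed

lemma sublinear_iff_tendsto:
  "sublinear b \<longleftrightarrow>
     ((\<lambda>n::int. 1 / of_int n * b n) \<longlongrightarrow> 0) at_top \<and>
     ((\<lambda>n::int. 1 / of_int n * b n) \<longlongrightarrow> 0) at_bot"
proof (intro iffI conjI)
  assume b: "sublinear b"
  show "((\<lambda>n::int. 1 / of_int n * b n) \<longlongrightarrow> 0) at_top"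
  proof (rule tendstoI)
    fix e :: real
    assume "e > 0"
    then obtain N where "\<And>n. \<bar>n\<bar> \<ge> N \<Longrightarrow> \<bar>1 / of_int n * b n\<bar> < e"
      using sublinear_imp_small_ratio[OF b] by blast
    then show "\<forall>\<^sub>F n in at_top. dist (1 / of_int n * b n) 0 < e"
      unfolding eventually_at_top_linorder by (intro exI[of _ N]) (auto simp: dist_real_def)
  qed
  show "((\<lambda>n::int. 1 / of_int n * b n) \<longlongrightarrow> 0) at_bot"
  proof (rule tendstoI)
    fix e :: real
    assume "e > 0"
    then obtain N where "\<And>n. \<bar>n\<bar> \<ge> N \<Longrightarrow> \<bar>1 / of_int n * b n\<bar> < e"
      using sublinear_imp_small_ratio[OF b] by blast
    then show "\<forall>\<^sub>F n in at_bot. dist (1 / of_int n * b n) 0 < e"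
      unfolding eventually_at_bot_linorder by (intro exI[of _ "- N"]) (auto simp: dist_real_def)
  qed
qed (use sublinear_if_tendsto in blast)

lemma sublinear_affine:
  assumes "sublinear b"
  shows "sublinear (\<lambda>n. c + real p * b n)"
  unfolding sublinear_def
proof (intro allI impI)
  fix \<delta> :: real
  assume "\<delta> > 0"
  then have "\<delta> / (real p + 1) > 0" by simp
  then obtain B where B: "\<And>n. \<bar>b n\<bar> \<le> B + \<delta> / (real p + 1) * \<bar>of_int n\<bar>"
    using assms unfolding sublinear_def by meson
  have "\<bar>c + real p * b n\<bar> \<le> (\<bar>c\<bar> + real p * B) + \<delta> * \<bar>of_int n\<bar>" for n
  proof -
    have "\<bar>c + real p * b n\<bar> \<le> \<bar>c\<bar> + real p * \<bar>b n\<bar>"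
      by (metis abs_mult abs_of_nat abs_triangle_ineq)
    also have "real p * \<bar>b n\<bar> \<le> real p * (B + \<delta> / (real p + 1) * \<bar>of_int n\<bar>)"
      by (intro mult_left_mono B) auto
    also have "\<dots> = real p * B + \<delta> * (real p / (real p + 1)) * \<bar>of_int n\<bar>"
      by (simp add: algebra_simps)
    also have "\<delta> * (real p / (real p + 1)) * \<bar>of_int n\<bar> \<le> \<delta> * 1 * \<bar>of_int n\<bar>"
      using \<open>\<delta> > 0\<close> by (intro mult_left_mono mult_right_mono) auto
    finally show ?thesis by simp
  qed
  then show "\<exists>B. \<forall>n. \<bar>c + real p * b n\<bar> \<le> B + \<delta> * \<bar>of_int n\<bar>" by blast
qed

section \<open>Tempered random variables\<close>

lemma tempered_iff_sublinear:
  "tempered M \<sigma> K \<longleftrightarrow>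
     K \<in> borel_measurable M \<and> (\<forall>\<omega>\<in>space M. 0 < K \<omega>) \<and>
     (AE \<omega> in M. sublinear (\<lambda>n. ln (K (int_iterate M \<sigma> n \<omega>))))"
  unfolding tempered_def sublinear_iff_tendsto ..

context invertible_ergodic_system
begin

lemma inv_on_in_space: "\<omega> \<in> space M \<Longrightarrow> inv_on M \<sigma> \<omega> \<in> space M"
  using measurable_space[OF measurable_inv] .

lemma inv_on_left: "\<omega> \<in> space M \<Longrightarrow> inv_on M \<sigma> (\<sigma> \<omega>) = \<omega>"
  using bij by (simp add: inv_on_def bij_betw_def the_inv_into_f_f)

lemma inv_on_right: "\<omega> \<in> space M \<Longrightarrow> \<sigma> (inv_on M \<sigma> \<omega>) = \<omega>"
  using bij by (simp add: inv_on_def bij_betw_def f_the_inv_into_f)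

lemma forward_in_space: "\<omega> \<in> space M \<Longrightarrow> (\<sigma> ^^ n) \<omega> \<in> space M"
  by (induction n) (auto intro: measurable_space[OF measurable])

lemma backward_in_space: "\<omega> \<in> space M \<Longrightarrow> (inv_on M \<sigma> ^^ n) \<omega> \<in> space M"
  by (induction n) (auto intro: inv_on_in_space)

lemma int_iterate_in_space: "\<omega> \<in> space M \<Longrightarrow> int_iterate M \<sigma> m \<omega> \<in> space M"
  by (simp add: int_iterate_def forward_in_space backward_in_space)

lemma int_iterate_backward: "int_iterate M \<sigma> (- int n) = inv_on M \<sigma> ^^ n"
  by (simp add: int_iterate_def)

lemma inv_on_int_iterate:
  assumes "\<omega> \<in> space M"
  shows "inv_on M \<sigma> (int_iterate M \<sigma> m \<omega>) = int_iterate M \<sigma> (m - 1) \<omega>"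
proof (cases "m > 0")
  case True
  then obtain k where "m = int k + 1"
    by (metis add.commute zero_less_imp_eq_int of_nat_Suc Suc_pred)
  then show ?thesis
    using assms by (simp add: int_iterate_def nat_add_distrib inv_on_left forward_in_space)
next
  case False
  then obtain k where "m = - int k"
    by (metis add.inverse_inverse neg_0_le_iff_le nonneg_int_cases not_less)
  moreover have "- int k - 1 = - int (Suc k)" by simp
  ultimately show ?thesis
    by (simp only: int_iterate_backward) simp
qed

lemma backward_int_iterate:
  assumes "\<omega> \<in> space M"
  shows "(inv_on M \<sigma> ^^ n) (int_iterate M \<sigma> m \<omega>) = int_iterate M \<sigma> (m - int n) \<omega>"
  by (induction n) (simp_all add: inv_on_int_iterate[OF assms] algebra_simps)

lemma backward_measurable [measurable]: "inv_on M \<sigma> ^^ n \<in> M \<rightarrow>\<^sub>M M"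
  using measurable_inv by (rule measurable_compose_n)

lemma backward_in_invariant:
  assumes "invariant_full_set M \<sigma> A" "\<omega> \<in> A"
  shows "(inv_on M \<sigma> ^^ n) \<omega> \<in> A"
proof (induction n)
  case (Suc n)
  let ?x = "(inv_on M \<sigma> ^^ n) \<omega>"
  have "?x \<in> space M"
    using Suc assms(1) sets.sets_into_space by (auto simp: invariant_full_set_def)
  then have "inv_on M \<sigma> ?x \<in> \<sigma> -` A \<inter> space M"
    using Suc by (simp add: inv_on_right inv_on_in_space)
  moreover have "\<sigma> -` A \<inter> space M = A"
    using assms(1) by (simp add: invariant_full_set_def)
  ultimately show ?case by simp
qed (use assms in simp)

lemma tempered_scaled_power:
  assumes "tempered M \<sigma> D" "c > 0"
  shows "tempered M \<sigma> (\<lambda>\<omega>. c * D \<omega> ^ p)"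
proof -
  have D: "D \<in> borel_measurable M" "\<And>\<omega>. \<omega> \<in> space M \<Longrightarrow> 0 < D \<omega>"
    and ae: "AE \<omega> in M. sublinear (\<lambda>n. ln (D (int_iterate M \<sigma> n \<omega>)))"
    using assms(1) by (auto simp: tempered_iff_sublinear)
  have "AE \<omega> in M. sublinear (\<lambda>n. ln (c * D (int_iterate M \<sigma> n \<omega>) ^ p))"
    using ae AE_space
  proof eventually_elim
    case (elim \<omega>)
    have "ln (c * D (int_iterate M \<sigma> n \<omega>) ^ p) = ln c + real p * ln (D (int_iterate M \<sigma> n \<omega>))" for n
    proof -
      have "0 < D (int_iterate M \<sigma> n \<omega>)"
        using D(2) elim(2) int_iterate_in_space by blast
      then show ?thesis using assms(2) by (simp add: ln_mult ln_realpow)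
    qed
    then show ?case using sublinear_affine[OF elim(1)] by simp
  qed
  then show ?thesis
    using D assms(2) by (auto simp: tempered_iff_sublinear)
qed

text \<open>
  The supremum is taken in \<open>ennreal\<close> because it may be infinite on a null set, where a real
  supremum has no meaning; in \<open>ennreal\<close> countable suprema preserve measurability.
\<close>

definition backward_sup :: "real \<Rightarrow> ('o \<Rightarrow> real) \<Rightarrow> 'o \<Rightarrow> ennreal" where
  "backward_sup \<delta> C \<omega> =
     (SUP n::nat. ennreal (C ((inv_on M \<sigma> ^^ n) \<omega>) * exp (- (\<delta> * real n))))"

text \<open>
  This is what makes the envelope tempered. The supremum is formed with the rate \<open>\<delta>\<close>, but it is
  bounded along the orbit at any smaller rate \<open>\<eta>\<close> at which \<open>C\<close> is bounded: at the index
  \<open>m - n\<close>, the triangle inequality splits \<open>\<eta> * \<bar>m - n\<bar>\<close> into \<open>\<eta> * \<bar>m\<bar>\<close> and \<open>\<eta> * n\<close>, and the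
  latter is absorbed by the weight \<open>exp (- (\<delta> * n))\<close>.
\<close>

lemma backward_sup_le:
  assumes pos: "\<And>\<omega>. \<omega> \<in> space M \<Longrightarrow> 0 < C \<omega>"
    and \<omega>: "\<omega> \<in> space M" and \<eta>: "0 \<le> \<eta>" "\<eta> \<le> \<delta>"
    and B: "\<And>n. \<bar>ln (C (int_iterate M \<sigma> n \<omega>))\<bar> \<le> B + \<eta> * \<bar>of_int n\<bar>"
  shows "backward_sup \<delta> C (int_iterate M \<sigma> m \<omega>) \<le> ennreal (exp (B + \<eta> * \<bar>of_int m\<bar>))"
  unfolding backward_sup_def
proof (intro SUP_least ennreal_leI)
  fix n :: nat
  let ?c = "C (int_iterate M \<sigma> (m - int n) \<omega>)"
  have "0 < ?c" using pos int_iterate_in_space[OF \<omega>] by blast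
  moreover have "ln ?c \<le> B + \<eta> * \<bar>of_int m\<bar> + \<delta> * real n"
  proof -
    have "\<eta> * \<bar>of_int (m - int n)\<bar> \<le> \<eta> * (\<bar>of_int m\<bar> + real n)"
      using \<eta> by (intro mult_left_mono) auto
    moreover have "\<eta> * real n \<le> \<delta> * real n"
      using \<eta> by (intro mult_right_mono) auto
    ultimately show ?thesis using B[of "m - int n"] by (simp add: algebra_simps)
  qed
  ultimately have "?c \<le> exp (B + \<eta> * \<bar>of_int m\<bar> + \<delta> * real n)"
    by (metis exp_le_cancel_iff exp_ln)
  then have "?c * exp (- (\<delta> * real n)) \<le> exp (B + \<eta> * \<bar>of_int m\<bar> + \<delta> * real n) * exp (- (\<delta> * real n))"
    by (intro mult_right_mono) auto
  then show "C ((inv_on M \<sigma> ^^ n) (int_iterate M \<sigma> m \<omega>)) * exp (- (\<delta> * real n))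
      \<le> exp (B + \<eta> * \<bar>of_int m\<bar>)"
    by (simp add: backward_int_iterate[OF \<omega>] flip: exp_add)
qed

text \<open>
  The envelope is the supremum of the damped past values, raised to at least \<open>1\<close> so that it also
  bounds the identity map and its powers are monotone in the exponent.
\<close>

lemma tempered_envelope:
  assumes C: "tempered M \<sigma> C" and \<delta>: "\<delta> > 0"
  obtains D where "tempered M \<sigma> D" "\<And>\<omega>. 1 \<le> D \<omega>"
    "AE \<omega> in M. \<forall>n. C ((inv_on M \<sigma> ^^ n) \<omega>) \<le> D \<omega> * exp (\<delta> * real n)"
proof
  define D where "D \<omega> = max 1 (enn2real (backward_sup \<delta> C \<omega>))" for \<omega>
  have C_meas [measurable]: "C \<in> borel_measurable M"
    and pos: "\<And>\<omega>. \<omega> \<in> space M \<Longrightarrow> 0 < C \<omega>"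
    and ae: "AE \<omega> in M. sublinear (\<lambda>n. ln (C (int_iterate M \<sigma> n \<omega>)))"
    using C by (auto simp: tempered_iff_sublinear)
  show D1: "1 \<le> D \<omega>" for \<omega> by (simp add: D_def)
  have D_meas: "D \<in> borel_measurable M"
    unfolding D_def backward_sup_def by measurable
  have "AE \<omega> in M. sublinear (\<lambda>n. ln (D (int_iterate M \<sigma> n \<omega>)))"
    using ae AE_space
  proof eventually_elim
    case (elim \<omega>)
    show ?case unfolding sublinear_def
    proof (intro allI impI)
      fix \<eta>' :: real
      assume "\<eta>' > 0"
      (* The absorption in the weight needs a rate of at most \<delta>; a smaller rate only helps. *)
      define \<eta> where "\<eta> = min \<eta>' \<delta>"
      have \<eta>: "0 < \<eta>" "\<eta> \<le> \<delta>" "\<eta> \<le> \<eta>'" using \<open>\<eta>' > 0\<close> \<delta> by (auto simp: \<eta>_def)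
      obtain B where B: "\<And>n. \<bar>ln (C (int_iterate M \<sigma> n \<omega>))\<bar> \<le> B + \<eta> * \<bar>of_int n\<bar>"
        using elim(1) \<eta>(1) unfolding sublinear_def by meson
      have "0 \<le> B" using B[of 0] by simp
      have "\<bar>ln (D (int_iterate M \<sigma> m \<omega>))\<bar> \<le> B + \<eta>' * \<bar>of_int m\<bar>" for m
      proof -
        have "enn2real (backward_sup \<delta> C (int_iterate M \<sigma> m \<omega>)) \<le> exp (B + \<eta> * \<bar>of_int m\<bar>)"
          using backward_sup_le[OF pos elim(2) _ \<eta>(2) B, of m] \<eta>(1)
          by (intro enn2real_leI) auto
        moreover have "1 \<le> exp (B + \<eta> * \<bar>of_int m\<bar>)"
          using \<open>0 \<le> B\<close> \<eta>(1) by simp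
        ultimately have "D (int_iterate M \<sigma> m \<omega>) \<le> exp (B + \<eta> * \<bar>of_int m\<bar>)"
          by (simp add: D_def)
        then have "ln (D (int_iterate M \<sigma> m \<omega>)) \<le> ln (exp (B + \<eta> * \<bar>of_int m\<bar>))"
          using D1[of "int_iterate M \<sigma> m \<omega>"] by (intro ln_mono) auto
        then have "ln (D (int_iterate M \<sigma> m \<omega>)) \<le> B + \<eta> * \<bar>of_int m\<bar>" by simp
        moreover have "0 \<le> ln (D (int_iterate M \<sigma> m \<omega>))"
          using D1[of "int_iterate M \<sigma> m \<omega>"] by (rule ln_ge_zero)
        moreover have "\<eta> * \<bar>of_int m\<bar> \<le> \<eta>' * \<bar>of_int m\<bar>"
          using \<eta>(3) by (intro mult_right_mono) auto
        ultimately show ?thesis by linarith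
      qed
      then show "\<exists>B. \<forall>n. \<bar>ln (D (int_iterate M \<sigma> n \<omega>))\<bar> \<le> B + \<eta>' * \<bar>of_int n\<bar>" by blast
    qed
  qed
  then show "tempered M \<sigma> D"
    using D_meas D1 by (auto simp: tempered_iff_sublinear intro: less_le_trans[OF zero_less_one])
  show "AE \<omega> in M. \<forall>n. C ((inv_on M \<sigma> ^^ n) \<omega>) \<le> D \<omega> * exp (\<delta> * real n)"
    using ae AE_space
  proof eventually_elim
    case (elim \<omega>)
    obtain B where B: "\<And>n. \<bar>ln (C (int_iterate M \<sigma> n \<omega>))\<bar> \<le> B + \<delta> * \<bar>of_int n\<bar>"
      using elim(1) \<delta> unfolding sublinear_def by meson
    have fin: "backward_sup \<delta> C \<omega> < \<top>"
      using backward_sup_le[OF pos elim(2) _ order_refl B, of 0] \<delta>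
      by (simp add: int_iterate_def le_less_trans[OF _ ennreal_less_top])
    show ?case
    proof
      fix n
      let ?c = "C ((inv_on M \<sigma> ^^ n) \<omega>)"
      have "0 < ?c" using pos backward_in_space[OF elim(2)] by blast
      have "ennreal (?c * exp (- (\<delta> * real n))) \<le> backward_sup \<delta> C \<omega>"
        unfolding backward_sup_def by (rule SUP_upper) simp
      then have "enn2real (ennreal (?c * exp (- (\<delta> * real n)))) \<le> enn2real (backward_sup \<delta> C \<omega>)"
        using fin by (rule enn2real_mono)
      then have "?c * exp (- (\<delta> * real n)) \<le> D \<omega>"
        using \<open>0 < ?c\<close> by (simp add: D_def)
      then show "?c \<le> D \<omega> * exp (\<delta> * real n)"
        by (simp add: exp_minus field_simps)
    qed
  qed
qed

end

section \<open>Telescoping along the backward orbit\<close>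

text \<open>
  Here \<open>A j\<close> maps the fibre at backward time \<open>j + 1\<close> to the one at time \<open>j\<close>, and \<open>T j\<close> maps the
  latter to time \<open>0\<close>. Since \<open>T (Suc j) = T j \<circ> A j\<close>, consecutive terms \<open>T j (g j)\<close> differ by
  \<open>T j\<close> applied to the defect of equivariance of \<open>g\<close>. The growth bound is uniform in \<open>j\<close>, so the
  errors add up rather than multiply.
\<close>

lemma norm_telescoping_le:
  fixes emb :: "'s::real_normed_vector \<Rightarrow> 'w::real_normed_vector"
  assumes emb: "linear emb" and T: "\<And>j. linear (T j)"
    and T0: "\<And>x. T 0 x = x" and TS: "\<And>j x. T (Suc j) x = T j (A j x)"
    and bound: "\<And>j x. norm (emb (T j x)) \<le> K * norm (emb x)" and K: "0 \<le> K"
    and defect: "\<And>j. j < n \<Longrightarrow> norm (emb (g j - A j (g (Suc j)))) \<le> c"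
  shows "norm (emb (g 0 - T n (g n))) \<le> real n * (K * c)"
  using defect
proof (induction n)
  case 0
  then show ?case by (simp add: T0 linear_0[OF emb])
next
  case (Suc n)
  have "g 0 - T (Suc n) (g (Suc n)) = (g 0 - T n (g n)) + T n (g n - A n (g (Suc n)))"
    by (simp add: TS linear_diff[OF T])
  then have "norm (emb (g 0 - T (Suc n) (g (Suc n))))
      \<le> norm (emb (g 0 - T n (g n))) + norm (emb (T n (g n - A n (g (Suc n)))))"
    using linear_add[OF emb] norm_triangle_ineq by metis
  also have "\<dots> \<le> real n * (K * c) + K * c"
    using Suc bound[of n "g n - A n (g (Suc n))"] mult_left_mono[OF Suc.prems[of n] K]
    by (intro add_mono) auto
  finally show ?case by (simp add: algebra_simps)
qed

text \<open>
  The definition extends a cocycle at its final point; going further into the past extends it at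
  its starting point instead.
\<close>

lemma cocycle_Suc_first:
  "cocycle \<sigma> L (Suc n) \<omega> e x = cocycle \<sigma> L n (\<sigma> \<omega>) e (L \<omega> e x)"
  by (induction n) (simp_all add: funpow_swap1)

lemma cocycle_orbit:
  assumes "\<And>j. g ((\<sigma> ^^ Suc j) \<omega>) = L ((\<sigma> ^^ j) \<omega>) e (g ((\<sigma> ^^ j) \<omega>))"
  shows "cocycle \<sigma> L n \<omega> e (g \<omega>) = g ((\<sigma> ^^ n) \<omega>)"
  using assms by (induction n) simp_all

lemma linear_cocycle:
  assumes "\<And>j. linear (L ((\<sigma> ^^ j) \<omega>) e)"
  shows "linear (cocycle \<sigma> L n \<omega> e)"
proof (induction n)
  case 0
  then show ?case by (simp add: id_def linear_id[unfolded id_def])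
next
  case (Suc n)
  from linear_compose[OF this assms] show ?case by (simp only: cocycle.simps)
qed

section \<open>Choosing how far to go into the past\<close>

text \<open>
  Up to rounding, \<open>n = ln (1 / e) / \<Lambda>\<close>, so that \<open>exp (- \<Lambda> n)\<close> is comparable to \<open>e\<close>. The factor
  \<open>n\<close> is traded for another \<open>exp (\<Lambda> n / 4)\<close>. The first term is then about \<open>exp (\<Lambda> n / 2) * e\<close>, of
  the order of the square root of \<open>e\<close>; the second is about \<open>e powr (3/4)\<close>, which is smaller.
\<close>

lemma balance_exponentials:
  fixes \<Lambda> e :: real
  assumes "\<Lambda> > 0" "0 < e" "e < 1"
  obtains n :: nat where "1 \<le> n"
    "real n * exp (\<Lambda> / 4 * real n) * e + 2 * (exp (\<Lambda> / 4 * real n) * exp (- \<Lambda> * real n))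
       \<le> (4 / \<Lambda> * exp (\<Lambda> / 2) + 2) * e powr (1/2)"
proof
  define t where "t = - ln e / \<Lambda>"
  define n where "n = nat \<lceil>t\<rceil>"
  have "t > 0" using assms by (simp add: t_def divide_neg_pos)
  then show "1 \<le> n" unfolding n_def by linarith
  have n: "t \<le> real n" "real n \<le> t + 1" using \<open>t > 0\<close> unfolding n_def by linarith+
  have \<Lambda>t: "\<Lambda> * t = - ln e" using assms by (simp add: t_def)
  have lo: "- ln e \<le> \<Lambda> * real n"
    using mult_left_mono[OF n(1), of \<Lambda>] assms \<Lambda>t by simp
  have hi: "\<Lambda> * real n \<le> \<Lambda> - ln e"
    using mult_left_mono[OF n(2), of \<Lambda>] assms \<Lambda>t by (simp add: algebra_simps)
  have root: "e powr (1/2) = exp (ln e / 2)" using assms by (simp add: powr_def)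
  have "\<Lambda> / 4 * real n \<le> exp (\<Lambda> / 4 * real n)"
    using exp_ge_add_one_self[of "\<Lambda> / 4 * real n"] by linarith
  then have "real n \<le> 4 / \<Lambda> * exp (\<Lambda> / 4 * real n)"
    using assms by (simp add: field_simps)
  then have "real n * exp (\<Lambda> / 4 * real n) * e
      \<le> (4 / \<Lambda> * exp (\<Lambda> / 4 * real n)) * exp (\<Lambda> / 4 * real n) * e"
    using assms by (intro mult_right_mono) auto
  also have "\<dots> = 4 / \<Lambda> * exp (\<Lambda> / 4 * real n + \<Lambda> / 4 * real n + ln e)"
    unfolding exp_add using assms by simp
  also have "\<dots> \<le> 4 / \<Lambda> * exp (\<Lambda> / 2 + ln e / 2)"
    using assms hi by (intro mult_left_mono) auto
  finally have 1: "real n * exp (\<Lambda> / 4 * real n) * e \<le> 4 / \<Lambda> * exp (\<Lambda> / 2) * e powr (1/2)"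
    by (simp add: root exp_add)
  have "exp (\<Lambda> / 4 * real n) * exp (- \<Lambda> * real n) = exp (- (3/4) * (\<Lambda> * real n))"
    by (simp flip: exp_add)
  also have "\<dots> \<le> exp (ln e / 2)"
  proof -
    have "0 \<le> \<Lambda> * real n" using assms by simp
    then show ?thesis using lo by simp
  qed
  finally have 2: "exp (\<Lambda> / 4 * real n) * exp (- \<Lambda> * real n) \<le> e powr (1/2)"
    by (simp add: root)
  show "real n * exp (\<Lambda> / 4 * real n) * e + 2 * (exp (\<Lambda> / 4 * real n) * exp (- \<Lambda> * real n))
       \<le> (4 / \<Lambda> * exp (\<Lambda> / 2) + 2) * e powr (1/2)"
    using 1 2 by (simp add: distrib_right)
qed

section \<open>Stability of the equivariant family\<close>

theorem theorem8:
  fixes M :: "'o measure" and \<sigma> :: "'o \<Rightarrow> 'o"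
    and scale_w :: "'k::real_normed_field \<Rightarrow> 'w::banach \<Rightarrow> 'w"
    and scale_s :: "'k \<Rightarrow> 's::banach \<Rightarrow> 's"
    and emb :: "'s \<Rightarrow> 'w"
    and I :: "real set"
    and L_w :: "'o \<Rightarrow> real \<Rightarrow> 'w \<Rightarrow> 'w" and L_s :: "'o \<Rightarrow> real \<Rightarrow> 's \<Rightarrow> 's"
    and \<psi>_w :: "'w \<Rightarrow> 'k" and \<psi> :: "'s \<Rightarrow> 'k"
    and \<epsilon> :: "nat \<Rightarrow> real"
    and \<Omega>' :: "'o set" and C :: "'o \<Rightarrow> real" and h :: "'o \<Rightarrow> nat \<Rightarrow> 's"
  assumes "invertible_ergodic_system M \<sigma>"
    and "banach_over scale_w" and "banach_over scale_s"
    and "bounded_linear_over scale_s scale_w emb" and "inj emb"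
    and "\<And>x. norm (emb x) \<le> norm x"
    and "is_interval I" and "I \<subseteq> {-1<..<1}" and "0 \<in> I"
    and "\<And>\<omega> e. \<omega> \<in> space M \<Longrightarrow> e \<in> I \<Longrightarrow> bounded_linear_over scale_w scale_w (L_w \<omega> e)"
    and "\<And>\<omega> e. \<omega> \<in> space M \<Longrightarrow> e \<in> I \<Longrightarrow> bounded_linear_over scale_s scale_s (L_s \<omega> e)"
    and "\<And>\<omega> e x. \<omega> \<in> space M \<Longrightarrow> e \<in> I \<Longrightarrow> emb (L_s \<omega> e x) = L_w \<omega> e (emb x)"
    and "bounded_linear_over scale_s (*) \<psi>" and "\<exists>x. \<psi> x \<noteq> 0"
    and "bounded_linear_over scale_w (*) \<psi>_w" and "\<And>x. \<psi>_w (emb x) = \<psi> x"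
    and "\<And>\<omega> e x. \<omega> \<in> space M \<Longrightarrow> e \<in> I \<Longrightarrow> \<psi> (L_s \<omega> e x) = \<psi> x"
    and "\<epsilon> 0 = 0" and "\<And>k. 1 \<le> k \<Longrightarrow> \<epsilon> k \<in> I - {0}" and "\<epsilon> \<longlonglongrightarrow> 0"
    and "invariant_full_set M \<sigma> \<Omega>'" and "tempered M \<sigma> C"
    and "\<And>\<omega> k. \<omega> \<in> \<Omega>' \<Longrightarrow>
           \<psi> (h \<omega> k) = 1 \<and> L_s \<omega> (\<epsilon> k) (h \<omega> k) = h (\<sigma> \<omega>) k \<and> norm (h \<omega> k) \<le> C \<omega>"
    and "\<And>\<omega> n x. \<omega> \<in> \<Omega>' \<Longrightarrow> 1 \<le> n \<Longrightarrow>
           norm (emb (cocycle \<sigma> L_s n (int_iterate M \<sigma> (- int n) \<omega>) 0 x)) \<le> C \<omega> * norm (emb x)"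
    and "\<exists>\<Lambda>>0. \<forall>\<omega>\<in>\<Omega>'. \<forall>n\<ge>1. \<forall>x\<in>{x. \<psi> x = 0}.
           norm (emb (cocycle \<sigma> L_s n \<omega> 0 x)) \<le> C \<omega> * exp (- \<Lambda> * real n) * norm (emb x)"
    and "\<And>\<omega> k x. \<omega> \<in> \<Omega>' \<Longrightarrow> 1 \<le> k \<Longrightarrow>
           norm (emb (L_s \<omega> (\<epsilon> k) x - L_s \<omega> 0 x)) \<le> C \<omega> * \<bar>\<epsilon> k\<bar> * norm x"
  shows "(\<exists>C' r. tempered M \<sigma> C' \<and> 0 < r \<and>
            (AE \<omega> in M. \<forall>k\<ge>1. norm (emb (h \<omega> k) - emb (h \<omega> 0)) \<le> C' \<omega> * \<bar>\<epsilon> k\<bar> powr r))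
         \<and> (AE \<omega> in M. (\<lambda>k. emb (h \<omega> k)) \<longlonglongrightarrow> emb (h \<omega> 0))"
proof -
  interpret invertible_ergodic_system M \<sigma> by fact
  note emb_blin = assms(4) and emb_le = assms(6) and zero_I = assms(9)
    and L_blin = assms(11) and \<psi>_blin = assms(13) and \<epsilon>0 = assms(18) and \<epsilon>I = assms(19)
    and \<Omega>'_inv = assms(21) and C_temp = assms(22)
    and equivariant = assms(23) and growth = assms(24) and perturbation = assms(26)
  obtain \<Lambda> where \<Lambda>: "\<Lambda> > 0" and decay:
    "\<And>\<omega> n x. \<omega> \<in> \<Omega>' \<Longrightarrow> 1 \<le> n \<Longrightarrow> \<psi> x = 0 \<Longrightarrow>
       norm (emb (cocycle \<sigma> L_s n \<omega> 0 x)) \<le> C \<omega> * exp (- \<Lambda> * real n) * norm (emb x)"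
    using assms(25) by auto
  have emb: "linear emb" and \<psi>: "linear \<psi>"
    using emb_blin \<psi>_blin bounded_linear.linear by (auto simp: bounded_linear_over_def)
  have L_lin: "linear (L_s \<omega> 0)" if "\<omega> \<in> space M" for \<omega>
    using L_blin[OF that zero_I] bounded_linear.linear by (auto simp: bounded_linear_over_def)
  have \<Omega>'_space: "\<omega> \<in> space M" if "\<omega> \<in> \<Omega>'" for \<omega>
    using \<Omega>'_inv that sets.sets_into_space by (auto simp: invariant_full_set_def)
  have \<epsilon>_range: "0 < \<bar>\<epsilon> k\<bar>" "\<bar>\<epsilon> k\<bar> < 1" if "1 \<le> k" for k
    using \<epsilon>I[OF that] assms(8) by (auto simp: abs_less_iff)
  obtain D where D: "tempered M \<sigma> D" "\<And>\<omega>. 1 \<le> D \<omega>"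
    "AE \<omega> in M. \<forall>n. C ((inv_on M \<sigma> ^^ n) \<omega>) \<le> D \<omega> * exp (\<Lambda> / 8 * real n)"
    using tempered_envelope[OF C_temp, of "\<Lambda> / 8"] \<Lambda> by auto
  define c where "c = 4 / \<Lambda> * exp (\<Lambda> / 2) + 2"
  have c: "c > 0" using \<Lambda> by (simp add: c_def add_pos_pos)
  have fiber: "norm (emb (h \<omega> k) - emb (h \<omega> 0)) \<le> c * D \<omega> ^ 3 * \<bar>\<epsilon> k\<bar> powr (1/2)"
    if \<omega>: "\<omega> \<in> \<Omega>'" and env: "\<And>n. C ((inv_on M \<sigma> ^^ n) \<omega>) \<le> D \<omega> * exp (\<Lambda> / 8 * real n)"
      and k: "1 \<le> k" for \<omega> k
  proof -
    define \<theta> where "\<theta> j = (inv_on M \<sigma> ^^ j) \<omega>" for j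
    define T where "T j = cocycle \<sigma> L_s j (\<theta> j) 0" for j
    have \<theta>_in: "\<theta> j \<in> \<Omega>'" for j
      unfolding \<theta>_def by (rule backward_in_invariant[OF \<Omega>'_inv \<omega>])
    have \<theta>_Suc: "\<sigma> (\<theta> (Suc j)) = \<theta> j" for j
      using inv_on_right[OF \<Omega>'_space[OF \<theta>_in[of j]]] by (simp add: \<theta>_def)
    have \<theta>_forward: "(\<sigma> ^^ n) (\<theta> n) = \<omega>" for n
    proof (induction n)
      case 0
      then show ?case by (simp add: \<theta>_def)
    next
      case (Suc n)
      then show ?case by (simp only: funpow_Suc_right comp_apply \<theta>_Suc)
    qed
    have forward_in: "(\<sigma> ^^ j) x \<in> \<Omega>'" if "x \<in> \<Omega>'" for j x
      using that \<Omega>'_inv by (induction j) (auto simp: invariant_full_set_def)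
    have T_lin: "linear (T j)" for j
      unfolding T_def by (intro linear_cocycle L_lin \<Omega>'_space forward_in \<theta>_in)
    have C_le: "0 < C (\<theta> j)" "C (\<theta> j) \<le> D \<omega> * exp (\<Lambda> / 8 * real j)" for j
      using C_temp \<Omega>'_space[OF \<theta>_in] env by (auto simp: tempered_def \<theta>_def)
    (* C enters squared: once from an operator bound and once from the strong norm of h. *)
    have sq: "C (\<theta> j) * C (\<theta> j) \<le> D \<omega> ^ 2 * exp (\<Lambda> / 4 * real j)" for j
    proof -
      have "C (\<theta> j) * C (\<theta> j) \<le> (D \<omega> * exp (\<Lambda> / 8 * real j)) * (D \<omega> * exp (\<Lambda> / 8 * real j))"
        using C_le[of j] D(2)[of \<omega>] by (intro mult_mono) auto
      also have "\<dots> = D \<omega> ^ 2 * (exp (\<Lambda> / 8 * real j) * exp (\<Lambda> / 8 * real j))"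
        by (simp add: power2_eq_square)
      also have "exp (\<Lambda> / 8 * real j) * exp (\<Lambda> / 8 * real j) = exp (\<Lambda> / 4 * real j)"
        by (simp flip: exp_add)
      finally show ?thesis .
    qed
    have T_bound: "norm (emb (T j x)) \<le> D \<omega> * norm (emb x)" for j x
    proof (cases "j = 0")
      case True
      then show ?thesis
        using D(2)[of \<omega>] mult_right_mono[of 1 "D \<omega>" "norm (emb x)"] by (simp add: T_def)
    next
      case False
      then have "norm (emb (T j x)) \<le> C \<omega> * norm (emb x)"
        using growth[OF \<omega>, of j x] by (simp add: T_def \<theta>_def int_iterate_backward)
      also have "\<dots> \<le> D \<omega> * norm (emb x)"
        using env[of 0] by (intro mult_right_mono) auto
      finally show ?thesis .
    qed
    obtain n where n: "1 \<le> n"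
      "real n * exp (\<Lambda> / 4 * real n) * \<bar>\<epsilon> k\<bar>
         + 2 * (exp (\<Lambda> / 4 * real n) * exp (- \<Lambda> * real n)) \<le> c * \<bar>\<epsilon> k\<bar> powr (1/2)"
      using balance_exponentials[OF \<Lambda> \<epsilon>_range[OF k]] unfolding c_def by metis
    let ?E = "exp (\<Lambda> / 4 * real n)"
    have defect: "norm (emb (h (\<theta> j) k - L_s (\<theta> (Suc j)) 0 (h (\<theta> (Suc j)) k)))
        \<le> D \<omega> ^ 2 * ?E * \<bar>\<epsilon> k\<bar>" if "j < n" for j
    proof -
      let ?x = "\<theta> (Suc j)"
      have h: "h (\<theta> j) k = L_s ?x (\<epsilon> k) (h ?x k)" "norm (h ?x k) \<le> C ?x"
        using equivariant[OF \<theta>_in[of "Suc j"], of k] by (auto simp: \<theta>_Suc)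
      have "norm (emb (h (\<theta> j) k - L_s ?x 0 (h ?x k))) \<le> C ?x * \<bar>\<epsilon> k\<bar> * norm (h ?x k)"
        unfolding h(1) by (rule perturbation[OF \<theta>_in k])
      also have "\<dots> \<le> C ?x * \<bar>\<epsilon> k\<bar> * C ?x"
        using h(2) C_le(1)[of "Suc j"] by (intro mult_left_mono) auto
      also have "\<dots> = (C ?x * C ?x) * \<bar>\<epsilon> k\<bar>" by simp
      also have "\<dots> \<le> (D \<omega> ^ 2 * exp (\<Lambda> / 4 * real (Suc j))) * \<bar>\<epsilon> k\<bar>"
        by (intro mult_right_mono sq) auto
      (* The defect at step j involves the fibre at time j + 1, which is still at most n. *)
      also have "\<dots> \<le> D \<omega> ^ 2 * ?E * \<bar>\<epsilon> k\<bar>"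
        using that \<Lambda> by (intro mult_right_mono mult_left_mono) auto
      finally show ?thesis .
    qed
    have "norm (emb (h (\<theta> 0) k - T n (h (\<theta> n) k))) \<le> real n * (D \<omega> * (D \<omega> ^ 2 * ?E * \<bar>\<epsilon> k\<bar>))"
    proof (rule norm_telescoping_le[where A = "\<lambda>j. L_s (\<theta> (Suc j)) 0"
          and g = "\<lambda>j. h (\<theta> j) k", OF emb T_lin _ _ T_bound _ defect])
      show "T (Suc j) x = T j (L_s (\<theta> (Suc j)) 0 x)" for j x
        unfolding T_def cocycle_Suc_first \<theta>_Suc ..
      show "0 \<le> D \<omega>" using D(2)[of \<omega>] by linarith
    qed (simp_all add: T_def)
    then have near: "norm (emb (h \<omega> k - T n (h (\<theta> n) k))) \<le> D \<omega> ^ 3 * (real n * ?E * \<bar>\<epsilon> k\<bar>)"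
      by (simp add: \<theta>_def power3_eq_cube power2_eq_square mult_ac)
    have T_h: "T n (h (\<theta> n) 0) = h \<omega> 0"
      unfolding T_def
    proof (subst cocycle_orbit[where g = "\<lambda>x. h x 0"])
      show "h ((\<sigma> ^^ Suc j) (\<theta> n)) 0 = L_s ((\<sigma> ^^ j) (\<theta> n)) 0 (h ((\<sigma> ^^ j) (\<theta> n)) 0)" for j
        using equivariant[OF forward_in[OF \<theta>_in[of n]], of j 0] \<epsilon>0 by simp
    qed (simp add: \<theta>_forward)
    let ?d = "h (\<theta> n) k - h (\<theta> n) 0"
    have "norm ?d \<le> 2 * C (\<theta> n)"
      using equivariant[OF \<theta>_in[of n], of k] equivariant[OF \<theta>_in[of n], of 0]
        norm_triangle_ineq4[of "h (\<theta> n) k" "h (\<theta> n) 0"] by linarith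
    then have d_le: "norm (emb ?d) \<le> 2 * C (\<theta> n)"
      using emb_le[of ?d] by linarith
    have "\<psi> ?d = 0"
      using equivariant[OF \<theta>_in[of n]] by (simp add: linear_diff[OF \<psi>])
    then have "norm (emb (T n ?d)) \<le> C (\<theta> n) * exp (- \<Lambda> * real n) * norm (emb ?d)"
      unfolding T_def by (rule decay[OF \<theta>_in n(1)])
    also have "\<dots> \<le> C (\<theta> n) * exp (- \<Lambda> * real n) * (2 * C (\<theta> n))"
      using d_le C_le(1)[of n] by (intro mult_left_mono) auto
    also have "\<dots> = (C (\<theta> n) * C (\<theta> n)) * (2 * exp (- \<Lambda> * real n))" by simp
    also have "\<dots> \<le> (D \<omega> ^ 2 * ?E) * (2 * exp (- \<Lambda> * real n))"
      by (intro mult_right_mono sq) auto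
    also have "\<dots> \<le> (D \<omega> ^ 3 * ?E) * (2 * exp (- \<Lambda> * real n))"
      using D(2)[of \<omega>] by (intro mult_right_mono power_increasing) auto
    finally have far: "norm (emb (T n ?d)) \<le> D \<omega> ^ 3 * (2 * (?E * exp (- \<Lambda> * real n)))"
      by (simp add: mult_ac)
    have "h \<omega> k - h \<omega> 0 = (h \<omega> k - T n (h (\<theta> n) k)) + T n ?d"
      by (simp add: T_h linear_diff[OF T_lin])
    then have "emb (h \<omega> k) - emb (h \<omega> 0) = emb (h \<omega> k - T n (h (\<theta> n) k)) + emb (T n ?d)"
      using linear_add[OF emb] linear_diff[OF emb] by metis
    then have "norm (emb (h \<omega> k) - emb (h \<omega> 0))
        \<le> norm (emb (h \<omega> k - T n (h (\<theta> n) k))) + norm (emb (T n ?d))"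
      using norm_triangle_ineq by metis
    also have "\<dots> \<le> D \<omega> ^ 3 * (real n * ?E * \<bar>\<epsilon> k\<bar> + 2 * (?E * exp (- \<Lambda> * real n)))"
      using near far by (simp add: distrib_left)
    also have "\<dots> \<le> D \<omega> ^ 3 * (c * \<bar>\<epsilon> k\<bar> powr (1/2))"
      using n(2) D(2)[of \<omega>] by (intro mult_left_mono) auto
    finally show ?thesis by (simp add: mult_ac)
  qed
  have "AE \<omega> in M. \<omega> \<in> \<Omega>'"
    using \<Omega>'_inv by (intro AE_prob_1) (simp add: invariant_full_set_def)
  with D(3) have bound:
    "AE \<omega> in M. \<forall>k\<ge>1. norm (emb (h \<omega> k) - emb (h \<omega> 0)) \<le> (c * D \<omega> ^ 3) * \<bar>\<epsilon> k\<bar> powr (1/2)"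
    by eventually_elim (use fiber in auto)
  have "AE \<omega> in M. (\<lambda>k. emb (h \<omega> k)) \<longlonglongrightarrow> emb (h \<omega> 0)"
    using bound
  proof eventually_elim
    case (elim \<omega>)
    have "(\<lambda>k. \<bar>\<epsilon> k\<bar> powr (1/2)) \<longlonglongrightarrow> 0"
      by (rule tendsto_zero_powrI[OF tendsto_rabs_zero[OF assms(20)] tendsto_const]) simp_all
    then have lim: "(\<lambda>k. (c * D \<omega> ^ 3) * \<bar>\<epsilon> k\<bar> powr (1/2)) \<longlonglongrightarrow> 0"
      by (rule tendsto_mult_right_zero)
    have "\<forall>\<^sub>F k in sequentially. norm (emb (h \<omega> k) - emb (h \<omega> 0))
        \<le> (c * D \<omega> ^ 3) * \<bar>\<epsilon> k\<bar> powr (1/2)"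
      unfolding eventually_sequentially using elim by blast
    then have "(\<lambda>k. emb (h \<omega> k) - emb (h \<omega> 0)) \<longlonglongrightarrow> 0"
      using lim by (rule Lim_null_comparison)
    then show ?case by (simp add: LIM_zero_iff)
  qed
  moreover have "tempered M \<sigma> (\<lambda>\<omega>. c * D \<omega> ^ 3)"
    by (rule tempered_scaled_power[OF D(1) c])
  ultimately show ?thesis
    using bound by (meson half_gt_zero zero_less_one)
qed

end
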